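(* Let $(X,d,\mu)$ be a geodesic metric measure space with a doubling measure $\mu$. Then $\mu$ is continuous with respect to the metric $d$, i.e. for all $x\in X$ and all $r>0$, $\lim_{y\to x}\mu(B(x,r)\,\Delta\, B(y,r))=0$.
   Context: Standing assumptions: $(X,d,\mu)$ is a metric space with a Borel regular measure $\mu$ with $0<\mu(B)<\infty$ for every ball $B$, and $X$ is proper (closed bounded sets are compact). $B(x,r)=\{y: d(x,y)<r\}$. $\mu$ is doubling if there is $C_\mu>0$ with $\mu(B(x,2r))\le C_\mu\,\mu(B(x,r))$ for all balls. $X$ is geodesic if any two points $x,y$ can be joined by a curve whose length equals $d(x,y)$. $A\Delta B=(A\setminus B)\cup(B\setminus A)$. *)

theory Defs
  imports "HOL-Analysis.Analysis"
begin

(* The sigma-algebra may be larger than the Borel one (for instance that of the Caratheodory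
   measurable sets of a Borel regular outer measure). As UNIV is a Borel set, space M = UNIV. *)
definition borel_regular :: "'a::topological_space measure \<Rightarrow> bool" where
  "borel_regular M \<longleftrightarrow>
     sets borel \<subseteq> sets M \<and>
     (\<forall>A\<in>sets M. \<exists>B\<in>sets borel. A \<subseteq> B \<and> emeasure M B = emeasure M A)"

definition doubling_measure :: "'a::metric_space measure \<Rightarrow> bool" where
  "doubling_measure M \<longleftrightarrow>
     (\<exists>C::real. C > 0 \<and>
        (\<forall>x r. r > 0 \<longrightarrow> emeasure M (ball x (2 * r)) \<le> ennreal C * emeasure M (ball x r)))"

(* Supremum over all partitions; a partition is given as the sorted list of its points. *)
definition curve_length :: "(real \<Rightarrow> 'a::metric_space) \<Rightarrow> ennreal" where
  "curve_length g =
     (SUP ts \<in> {ts. sorted ts \<and> set ts \<subseteq> {0..1}}.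
        \<Sum>i<length ts - 1. ennreal (dist (g (ts ! i)) (g (ts ! Suc i))))"

definition geodesic_space :: "'a::metric_space itself \<Rightarrow> bool" where
  "geodesic_space _ \<longleftrightarrow>
     (\<forall>x y::'a. \<exists>g. path g \<and> pathstart g = x \<and> pathfinish g = y \<and>
        curve_length g = ennreal (dist x y))"

definition proper_space :: "'a::metric_space itself \<Rightarrow> bool" where
  "proper_space _ \<longleftrightarrow> (\<forall>S::'a set. closed S \<and> bounded S \<longrightarrow> compact S)"

end

theory Submission
  imports Defs
begin

text \<open>
  It suffices that spheres are null sets, as the symmetric difference of \<open>B(x,r)\<close> and \<open>B(y,r)\<close> lies
  in an annulus that shrinks to the sphere around \<open>x\<close> when \<open>y \<rightarrow> x\<close>. Cover the sphere by finitely
  many balls \<open>B(z,6s)\<close> such that the balls \<open>B(z,2s)\<close> are disjoint. On a geodesic from \<open>z\<close> to \<open>x\<close>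
  choose \<open>w\<close> at distance \<open>s\<close> from \<open>z\<close>. The balls \<open>B(w,s/2)\<close> are disjoint, they lie in the open annulus
  of width \<open>2s\<close> inside the sphere, and by doubling they carry a fixed fraction of the measure of
  \<open>B(z,6s)\<close>. So the measure of the sphere is at most a constant times that of the annulus, which
  tends to \<open>0\<close> with \<open>s\<close>.
\<close>

text \<open>The partition \<open>[0,t,1]\<close> is one of those in the supremum. On a curve as long
  as the distance of its endpoints this forces equality in the triangle inequality at each of its
  points.\<close>

lemma curve_length_ge_via_point:
  assumes "t \<in> {0..1}"
  shows "ennreal (dist (g 0) (g t) + dist (g t) (g 1)) \<le> curve_length g"
proof -
  have "(\<Sum>i<length [0,t,1] - 1. ennreal (dist (g ([0,t,1] ! i)) (g ([0,t,1] ! Suc i))))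
      \<le> curve_length g"
    unfolding curve_length_def by (rule SUP_upper) (use assms in auto)
  then show ?thesis
    by (simp add: numeral_2_eq_2)
qed

text \<open>Along a geodesic from \<open>z\<close> to \<open>x\<close> the distance from
  \<open>z\<close> varies continuously from 0 to \<open>dist z x\<close>, so it takes the value
  \<open>s\<close>. The length of the geodesic leaves no slack for the remaining distance to
  \<open>x\<close>.\<close>

lemma geodesic_space_point_at_distance:
  fixes x z :: "'a::metric_space"
  assumes "geodesic_space TYPE('a)" and "0 \<le> s" "s \<le> dist z x"
  obtains w where "dist z w = s" "dist w x = dist z x - s"
proof -
  obtain g where g: "path g" "g 0 = z" "g 1 = x" "curve_length g = ennreal (dist z x)"
    using assms(1) unfolding geodesic_space_def pathstart_def pathfinish_def by metis
  have "continuous_on {0..1} (\<lambda>t. dist z (g t))"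
    using g(1) unfolding path_def by (intro continuous_intros)
  then obtain t where t: "0 \<le> t" "t \<le> 1" "dist z (g t) = s"
    using IVT'[of "\<lambda>t. dist z (g t)" 0 s 1] assms g by auto
  have "dist z (g t) + dist (g t) x \<le> dist z x"
    using curve_length_ge_via_point[of t g] t(1,2) g by (simp del: ennreal_plus)
  moreover have "dist z x \<le> dist z (g t) + dist (g t) x"
    by (rule dist_triangle)
  ultimately show thesis
    using that[of "g t"] t(3) by simp
qed

lemma doubling_iterate:
  fixes M :: "'a::metric_space measure"
  assumes "\<And>x r. r > 0 \<Longrightarrow> emeasure M (ball x (2 * r)) \<le> K * emeasure M (ball x r)" and "r > 0"
  shows "emeasure M (ball x (2 ^ n * r)) \<le> K ^ n * emeasure M (ball x r)"
proof (induction n)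
  case (Suc n)
  have "emeasure M (ball x (2 ^ Suc n * r)) \<le> K * emeasure M (ball x (2 ^ n * r))"
    using assms(1)[of "2 ^ n * r" x] \<open>r > 0\<close> by (simp add: mult.assoc)
  also have "\<dots> \<le> K * (K ^ n * emeasure M (ball x r))"
    by (rule mult_left_mono[OF Suc.IH]) simp
  finally show ?case
    by (simp add: mult.assoc)
qed simp

text \<open>Greedy selection: a new point joins \<open>C\<close> only if no chosen point is closer
  than \<open>d\<close>. This serves as a finite Vitali covering argument.\<close>

lemma finite_maximal_separated_subset:
  fixes K :: "'a::metric_space set"
  assumes "finite K" and "0 < d"
  obtains C where "C \<subseteq> K" "pairwise (\<lambda>a b. d \<le> dist a b) C" "\<And>z. z \<in> K \<Longrightarrow> \<exists>c\<in>C. dist z c < d"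
proof -
  have "\<exists>C\<subseteq>K. pairwise (\<lambda>a b. d \<le> dist a b) C \<and> (\<forall>z\<in>K. \<exists>c\<in>C. dist z c < d)"
    using assms(1)
  proof (induction K)
    case empty
    then show ?case by simp
  next
    case (insert a K)
    then obtain C where C: "C \<subseteq> K" "pairwise (\<lambda>a b. d \<le> dist a b) C" "\<forall>z\<in>K. \<exists>c\<in>C. dist z c < d"
      by blast
    show ?case
    proof (cases "\<exists>c\<in>C. dist a c < d")
      case True
      with C show ?thesis
        by (intro exI[of _ C]) auto
    next
      case False
      with C \<open>0 < d\<close> show ?thesis
        by (intro exI[of _ "insert a C"]) (auto simp: pairwise_insert dist_commute not_less)
    qed
  qed
  with that show thesis
    by blast
qed

lemma emeasure_sphere_le_annulus:
  fixes M :: "'a::metric_space measure"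
  assumes "proper_space TYPE('a)" "geodesic_space TYPE('a)" "sets borel \<subseteq> sets M"
    and dbl: "\<And>x r. r > 0 \<Longrightarrow> emeasure M (ball x (2 * r)) \<le> K * emeasure M (ball x r)"
    and s: "0 < s" "s \<le> r"
  shows "emeasure M (sphere x r) \<le> K ^ 4 * emeasure M (ball x r - ball x (r - 2 * s))"
proof -
  have meas: "A \<in> sets M" if "A \<in> sets borel" for A
    using assms(3) that by blast
  have "closed (sphere x r)"
    unfolding sphere_def by (intro closed_Collect_eq continuous_intros)
  moreover have "bounded (sphere x r)"
    by (rule bounded_subset[OF bounded_cball sphere_cball])
  ultimately have "compact (sphere x r)"
    using assms(1) unfolding proper_space_def by blast
  then obtain k where k: "k \<subseteq> sphere x r" "finite k" "sphere x r \<subseteq> (\<Union>z\<in>k. ball z (2 * s))"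
    by (rule compactE_image[where f = "\<lambda>z. ball z (2 * s)" and C = "sphere x r"])
       (use s in auto)
  obtain C where C: "C \<subseteq> k" "pairwise (\<lambda>a b. 2 * (2 * s) \<le> dist a b) C"
      "\<And>z. z \<in> k \<Longrightarrow> \<exists>c\<in>C. dist z c < 2 * (2 * s)"
    using finite_maximal_separated_subset[OF k(2), of "2 * (2 * s)"] s by auto
  \<comment> \<open>The radius is 6s = 2s + 4s: a point of \<open>k\<close> lies within 2s of
    \<open>y\<close>, and a selected centre within 4s of that point.\<close>
  have cover: "sphere x r \<subseteq> (\<Union>z\<in>C. ball z (3 * (2 * s)))"
  proof
    fix y assume "y \<in> sphere x r"
    then obtain z where z: "z \<in> k" "dist z y < 2 * s"
      using k(3) by auto
    then obtain c where c: "c \<in> C" "dist z c < 2 * (2 * s)"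
      using C(3) by blast
    have "dist c y \<le> dist z c + dist z y"
      by (rule dist_triangle3)
    then show "y \<in> (\<Union>z\<in>C. ball z (3 * (2 * s)))"
      using z c by (auto intro!: bexI[of _ c])
  qed
  have fin: "finite C"
    using C(1) k(2) finite_subset by blast
  have "\<exists>w. dist z w = s \<and> dist w x = r - s" if "z \<in> C" for z
  proof -
    have "dist z x = r"
      using that C(1) k(1) by (auto simp: dist_commute)
    with s show ?thesis
      by (auto intro: geodesic_space_point_at_distance[OF assms(2), of s z x])
  qed
  then obtain w where w: "\<And>z. z \<in> C \<Longrightarrow> dist z (w z) = s" "\<And>z. z \<in> C \<Longrightarrow> dist (w z) x = r - s"
    by metis
  \<comment> \<open>Points of the small ball are within s + s/2 < 2s of \<open>z\<close>, so the
    small balls inherit disjointness from the balls of radius 2s, whose centres are at least 4s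
    apart.\<close>
  have sub: "ball (w z) (s / 2) \<subseteq> ball z (2 * s)" if "z \<in> C" for z
  proof
    fix y assume "y \<in> ball (w z) (s / 2)"
    then show "y \<in> ball z (2 * s)"
      using w(1)[OF that] dist_triangle[of z y "w z"] s by auto
  qed
  have disj: "disjoint_family_on (\<lambda>z. ball (w z) (s / 2)) C"
    unfolding disjoint_family_on_def
  proof (intro ballI impI)
    fix a b assume "a \<in> C" "b \<in> C" "a \<noteq> b"
    then have "2 * s + 2 * s \<le> dist a b"
      using C(2) unfolding pairwise_def by force
    then have "ball a (2 * s) \<inter> ball b (2 * s) = {}"
      by (rule disjoint_ballI)
    with \<open>a \<in> C\<close> \<open>b \<in> C\<close> show "ball (w a) (s / 2) \<inter> ball (w b) (s / 2) = {}"
      using sub by blast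
  qed
  \<comment> \<open>As \<open>w z\<close> is at distance r - s from \<open>x\<close>, the distances
    to \<open>x\<close> on this ball stay strictly between r - 3s/2 and r - s/2.\<close>
  have annulus: "ball (w z) (s / 2) \<subseteq> ball x r - ball x (r - 2 * s)" if "z \<in> C" for z
  proof
    fix y assume "y \<in> ball (w z) (s / 2)"
    then show "y \<in> ball x r - ball x (r - 2 * s)"
      using w(2)[OF that] dist_triangle[of x y "w z"] dist_triangle[of "w z" x y] s
      by (auto simp: dist_commute)
  qed
  have ball_le: "emeasure M (ball z (3 * (2 * s))) \<le> K ^ 4 * emeasure M (ball (w z) (s / 2))"
    if "z \<in> C" for z
  proof -
    \<comment> \<open>Radius 6s + s = 7s around \<open>w z\<close> would do. Four doublings of s/2
      give 8s, while three give only 4s; hence the exponent 4.\<close>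
    have "ball z (3 * (2 * s)) \<subseteq> ball (w z) (2 ^ 4 * (s / 2))"
    proof
      fix y assume "y \<in> ball z (3 * (2 * s))"
      then show "y \<in> ball (w z) (2 ^ 4 * (s / 2))"
        using w(1)[OF that] dist_triangle[of "w z" y z] s by (auto simp: dist_commute)
    qed
    then have "emeasure M (ball z (3 * (2 * s))) \<le> emeasure M (ball (w z) (2 ^ 4 * (s / 2)))"
      by (intro emeasure_mono meas) auto
    also have "\<dots> \<le> K ^ 4 * emeasure M (ball (w z) (s / 2))"
      by (rule doubling_iterate[OF dbl]) (use s in auto)
    finally show ?thesis .
  qed
  have "emeasure M (sphere x r) \<le> emeasure M (\<Union>z\<in>C. ball z (3 * (2 * s)))"
    by (intro emeasure_mono cover meas borel_open open_UN) auto
  also have "\<dots> \<le> (\<Sum>z\<in>C. emeasure M (ball z (3 * (2 * s))))"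
    by (intro emeasure_subadditive_finite fin) (auto intro: meas)
  also have "\<dots> \<le> (\<Sum>z\<in>C. K ^ 4 * emeasure M (ball (w z) (s / 2)))"
    by (intro sum_mono ball_le)
  also have "\<dots> = K ^ 4 * emeasure M (\<Union>z\<in>C. ball (w z) (s / 2))"
    by (subst sum_emeasure[symmetric]) (use disj fin in \<open>auto simp: sum_distrib_left intro: meas\<close>)
  also have "\<dots> \<le> K ^ 4 * emeasure M (ball x r - ball x (r - 2 * s))"
    by (intro mult_left_mono emeasure_mono meas) (use annulus in auto)
  finally show ?thesis .
qed

lemma emeasure_sphere_eq_0:
  fixes M :: "'a::metric_space measure"
  assumes "proper_space TYPE('a)" "geodesic_space TYPE('a)" "sets borel \<subseteq> sets M"
    and "doubling_measure M" and fin: "emeasure M (ball x r) < \<infinity>" and "r > 0"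
  shows "emeasure M (sphere x r) = 0"
proof -
  obtain C where C: "\<And>x r. r > 0 \<Longrightarrow> emeasure M (ball x (2 * r)) \<le> ennreal C * emeasure M (ball x r)"
    using assms(4) unfolding doubling_measure_def by blast
  \<comment> \<open>The factor \<open>r\<close> keeps \<open>s n\<close> at most \<open>r\<close>,
    so that a geodesic from the sphere to its centre is long enough.\<close>
  define s where "s n = r / real (Suc n)" for n
  have s: "0 < s n" "s n \<le> r" for n
    using \<open>r > 0\<close> by (auto simp: s_def field_simps)
  define D where "D n = ball x r - ball x (r - 2 * s n)" for n
  have D: "D n \<in> sets M" for n
    using assms(3) unfolding D_def by auto
  have "s n \<le> s m" if "m \<le> n" for m n
    using that \<open>r > 0\<close> unfolding s_def by (intro divide_left_mono) auto
  then have dec: "decseq D"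
    unfolding decseq_def D_def by fastforce
  have "s \<longlonglongrightarrow> 0"
    unfolding s_def by (rule LIMSEQ_Suc[OF lim_const_over_n])
  \<comment> \<open>The outer ball is open, so these annuli miss the sphere itself and shrink to
    nothing.\<close>
  have Int: "(\<Inter>n. D n) = {}"
  proof (rule equals0I)
    fix y assume y: "y \<in> (\<Inter>n. D n)"
    then have "dist x y < r" and ge: "\<And>n. r - 2 * s n \<le> dist x y"
      by (auto simp: D_def not_less)
    have "(\<lambda>n. r - 2 * s n) \<longlonglongrightarrow> r - 2 * 0"
      by (intro tendsto_intros \<open>s \<longlonglongrightarrow> 0\<close>)
    then have "r - 2 * 0 \<le> dist x y"
      by (rule LIMSEQ_le_const2) (use ge in blast)
    with \<open>dist x y < r\<close> show False
      by simp
  qed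
  have D_fin: "emeasure M (D n) \<noteq> \<infinity>" for n
  proof -
    have "emeasure M (D n) \<le> emeasure M (ball x r)"
      using assms(3) by (intro emeasure_mono) (auto simp: D_def)
    then show ?thesis
      using fin by (auto simp: top_unique)
  qed
  have "(\<lambda>n. emeasure M (D n)) \<longlonglongrightarrow> emeasure M (\<Inter>n. D n)"
    using D D_fin by (intro Lim_emeasure_decseq dec) blast+
  then have "(\<lambda>n. emeasure M (D n)) \<longlonglongrightarrow> 0"
    unfolding Int by simp
  \<comment> \<open>The limit passes through the product because the factor, coming from a real
    \<open>C\<close>, is finite.\<close>
  then have "(\<lambda>n. ennreal C ^ 4 * emeasure M (D n)) \<longlonglongrightarrow> ennreal C ^ 4 * 0"
    by (intro ennreal_tendsto_cmult) (simp_all add: power_less_top_ennreal)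
  then have "emeasure M (sphere x r) \<le> ennreal C ^ 4 * 0"
    by (rule LIMSEQ_le_const)
       (use emeasure_sphere_le_annulus[OF assms(1-3) C s] in \<open>auto simp: D_def\<close>)
  then show ?thesis
    by simp
qed

text \<open>For \<open>z\<close> in the symmetric difference, one of its distances to
  \<open>x\<close> and \<open>y\<close> is below \<open>r\<close> and the other is not, and the two
  differ by at most \<open>d\<close>.\<close>

lemma sym_diff_ball_subset_annulus:
  assumes "dist x y \<le> d"
  shows "sym_diff (ball x r) (ball y r) \<subseteq> cball x (r + d) - ball x (r - d)"
proof
  fix z assume "z \<in> sym_diff (ball x r) (ball y r)"
  then show "z \<in> cball x (r + d) - ball x (r - d)"
    using assms dist_triangle[of x z y] dist_triangle[of y z x] by (auto simp: dist_commute)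
qed

theorem proposition2p1:
  fixes M :: "'a::metric_space measure" and x :: 'a and r :: real
  assumes "proper_space TYPE('a)"
    and "borel_regular M"
    and "\<And>z s. s > 0 \<Longrightarrow> 0 < emeasure M (ball z s) \<and> emeasure M (ball z s) < \<infinity>"
    and "geodesic_space TYPE('a)"
    and "doubling_measure M"
    and "r > 0"
  shows "((\<lambda>y. emeasure M (sym_diff (ball x r) (ball y r))) \<longlongrightarrow> 0) (at x)"
proof -
  have borel: "sets borel \<subseteq> sets M"
    using assms(2) unfolding borel_regular_def by blast
  define s where "s n = 1 / real (Suc n)" for n
  have s: "0 < s n" "s n \<le> 1" for n
    by (auto simp: s_def)
  define D where "D n = cball x (r + s n) - ball x (r - s n)" for n
  have D: "D n \<in> sets M" for n
    using borel unfolding D_def by auto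
  have "s n \<le> s m" if "m \<le> n" for m n
    using that unfolding s_def by (intro divide_left_mono) auto
  then have dec: "decseq D"
    unfolding decseq_def D_def by fastforce
  have "s \<longlonglongrightarrow> 0"
    unfolding s_def by (rule LIMSEQ_Suc[OF lim_const_over_n])
  \<comment> \<open>Unlike the annuli inside the sphere, these surround it from both sides and
    shrink exactly to it.\<close>
  have Int: "(\<Inter>n. D n) = sphere x r"
  proof (intro equalityI subsetI)
    fix y assume y: "y \<in> (\<Inter>n. D n)"
    then have le: "dist x y \<le> r + s n" and ge: "r - s n \<le> dist x y" for n
      by (auto simp: D_def not_less)
    have "(\<lambda>n. r + s n) \<longlonglongrightarrow> r + 0" "(\<lambda>n. r - s n) \<longlonglongrightarrow> r - 0"
      by (intro tendsto_intros \<open>s \<longlonglongrightarrow> 0\<close>)+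
    then have "dist x y \<le> r + 0" "r - 0 \<le> dist x y"
      using le ge by (blast intro: LIMSEQ_le_const LIMSEQ_le_const2)+
    then show "y \<in> sphere x r"
      by simp
  next
    fix y assume "y \<in> sphere x r"
    then show "y \<in> (\<Inter>n. D n)"
      using s(1) by (auto simp: D_def less_imp_le not_less)
  qed
  have null: "emeasure M (sphere x r) = 0"
    using assms by (intro emeasure_sphere_eq_0 borel) auto
  have D_fin: "emeasure M (D n) \<noteq> \<infinity>" for n
  proof -
    \<comment> \<open>Finiteness is assumed for open balls; r + 2 exceeds the largest closed radius
      r + 1.\<close>
    have "D n \<subseteq> ball x (r + 2)"
    proof
      fix y assume "y \<in> D n"
      then show "y \<in> ball x (r + 2)"
        using s(2)[of n] by (auto simp: D_def)
    qed
    then have "emeasure M (D n) \<le> emeasure M (ball x (r + 2))"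
      using borel by (intro emeasure_mono) auto
    then show ?thesis
      using assms(3)[of "r + 2" x] \<open>r > 0\<close> by (auto simp: top_unique)
  qed
  have "(\<lambda>n. emeasure M (D n)) \<longlonglongrightarrow> emeasure M (\<Inter>n. D n)"
    using D D_fin by (intro Lim_emeasure_decseq dec) blast+
  then have lim: "(\<lambda>n. emeasure M (D n)) \<longlonglongrightarrow> 0"
    unfolding Int null .
  show ?thesis
  \<comment> \<open>Nothing in \<open>ennreal\<close> is below 0, so only the upper bounds
    \<open>e\<close> need an argument: one annulus of measure below \<open>e\<close> contains the
    symmetric differences for all \<open>y\<close> close to \<open>x\<close>.\<close>
  proof (rule order_tendstoI)
    fix e :: ennreal assume "0 < e"
    then obtain n where n: "emeasure M (D n) < e"
      using order_tendstoD(2)[OF lim] by (auto simp: eventually_sequentially)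
    have "\<forall>\<^sub>F y in at x. dist y x < s n"
      using s(1)[of n] by (auto simp: eventually_at)
    then show "\<forall>\<^sub>F y in at x. emeasure M (sym_diff (ball x r) (ball y r)) < e"
    proof eventually_elim
      case (elim y)
      then have "sym_diff (ball x r) (ball y r) \<subseteq> D n"
        unfolding D_def by (intro sym_diff_ball_subset_annulus) (simp add: dist_commute)
      then have "emeasure M (sym_diff (ball x r) (ball y r)) \<le> emeasure M (D n)"
        using D by (rule emeasure_mono)
      with n show ?case
        by simp
    qed
  qed simp
qed

end
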